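(* Let $G$ be a simple graph with $n$ vertices and minimum degree $\delta$ that satisfies $\delta(G)\geq 5$ or $\lambda(G)\geq 4$ or $\kappa(G)\geq 3$. Then $G$ contains at least $\frac{1}{30}\delta n$ pendant pairs.
   Context: $\lambda(G)$ is the edge-connectivity and $\kappa(G)$ the vertex-connectivity. For vertices $v\neq w$, $\lambda_G(v,w)$ is the minimum number of edges with exactly one endpoint in $X$, over all vertex sets $X$ containing exactly one of $v,w$. A pendant pair is an unordered pair $\{v,w\}$ of distinct vertices with $\lambda_G(v,w)=\min\{d_G(v),d_G(w)\}$. *)

theory Defs
  imports Complex_Main
begin

text \<open>
  A graph is given by its vertex set \<open>V\<close> and its edge set \<open>E\<close>, an edge being the two-element
  set of its endpoints.
\<close>

definition simple_graph :: "'a set \<Rightarrow> 'a set set \<Rightarrow> bool" where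
  "simple_graph V E \<longleftrightarrow> finite V \<and> (\<forall>e\<in>E. e \<subseteq> V \<and> card e = 2)"

definition degree :: "'a set set \<Rightarrow> 'a \<Rightarrow> nat" where
  "degree E v = card {e \<in> E. v \<in> e}"

definition min_degree :: "'a set \<Rightarrow> 'a set set \<Rightarrow> nat" where
  "min_degree V E = Min (degree E ` V)"

text \<open>The graph without vertices does not count as connected.\<close>

definition connected_graph :: "'a set \<Rightarrow> 'a set set \<Rightarrow> bool" where
  "connected_graph V E \<longleftrightarrow>
     V \<noteq> {} \<and> (\<forall>u\<in>V. \<forall>v\<in>V. (u, v) \<in> {(x, y). {x, y} \<in> E}\<^sup>*)"

text \<open>
  A graph with at most one vertex has edge-connectivity 0, as no deletion of edges disconnects a
  single vertex.
\<close>

definition edge_connectivity :: "'a set \<Rightarrow> 'a set set \<Rightarrow> nat" where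
  "edge_connectivity V E =
     (if card V \<le> 1 then 0
      else Min {card F |F. F \<subseteq> E \<and> \<not> connected_graph V (E - F)})"

text \<open>
  The second disjunct gives a complete graph on \<open>n \<ge> 1\<close> vertices, which has no separating vertex
  set, the usual vertex-connectivity \<open>n - 1\<close>.
\<close>

definition vertex_connectivity :: "'a set \<Rightarrow> 'a set set \<Rightarrow> nat" where
  "vertex_connectivity V E =
     Min {card S |S. S \<subseteq> V \<and>
       (\<not> connected_graph (V - S) {e \<in> E. e \<inter> S = {}} \<or> card (V - S) \<le> 1)}"

definition edge_cut :: "'a set set \<Rightarrow> 'a set \<Rightarrow> 'a set set" where
  "edge_cut E X = {e \<in> E. card (e \<inter> X) = 1}"

definition local_edge_connectivity :: "'a set \<Rightarrow> 'a set set \<Rightarrow> 'a \<Rightarrow> 'a \<Rightarrow> nat" where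
  "local_edge_connectivity V E v w =
     Min {card (edge_cut E X) |X. X \<subseteq> V \<and> (v \<in> X) \<noteq> (w \<in> X)}"

definition pendant_pairs :: "'a set \<Rightarrow> 'a set set \<Rightarrow> 'a set set" where
  "pendant_pairs V E =
     {{v, w} |v w. v \<in> V \<and> w \<in> V \<and> v \<noteq> w \<and>
        local_edge_connectivity V E v w = min (degree E v) (degree E w)}"

end

theory Submission
  imports Defs
begin

text \<open>
  Minimum cuts separating non-pendant pairs, with ties broken in favour of unbalanced cuts, are
  cross-free. A minimal family of such cuts that serves every non-pendant pair is therefore
  represented by a tree that partitions the vertices into blocks, and all pairs within a block
  are pendant. Every block contains a vertex whose degree exceeds all cuts around the block.
  Counting degrees in a simple graph then shows that a leaf block has at least \<open>\<delta> + 1\<close> vertices,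
  and that three consecutive blocks of degree 2 in the tree have at least \<open>\<delta> - 1\<close> vertices
  together; the connectivity assumption enters only to exclude that these are three single
  vertices for small \<open>\<delta>\<close>. Hence the pairs inside the blocks suffice, by induction along the tree.
\<close>

section \<open>Cuts and degree counting in a simple graph\<close>

locale finite_simple_graph =
  fixes V :: "'a set" and E :: "'a set set"
  assumes simple: "simple_graph V E"
begin

abbreviation d :: "'a set \<Rightarrow> nat" where
  "d X \<equiv> card (edge_cut E X)"

abbreviation deg :: "'a \<Rightarrow> nat" where
  "deg v \<equiv> degree E v"

abbreviation \<delta> :: nat where
  "\<delta> \<equiv> min_degree V E"

lemma finite_V: "finite V"
  using simple by (simp add: simple_graph_def)

lemma edge_subset: "e \<in> E \<Longrightarrow> e \<subseteq> V"
  using simple by (auto simp: simple_graph_def)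

lemma card_edge: "e \<in> E \<Longrightarrow> card e = 2"
  using simple by (auto simp: simple_graph_def)

lemma finite_E: "finite E"
  by (rule finite_subset[of _ "Pow V"]) (use edge_subset finite_V in auto)

lemma edgeE:
  assumes "e \<in> E"
  obtains a b where "a \<noteq> b" "e = {a, b}" "a \<in> V" "b \<in> V"
  using card_edge[OF assms] edge_subset[OF assms] by (auto simp: card_2_iff)

lemma card_doubleton_Int:
  assumes "a \<noteq> b"
  shows "card ({a, b} \<inter> X) = of_bool (a \<in> X) + of_bool (b \<in> X)"
  using assms by (cases "a \<in> X"; cases "b \<in> X") auto

lemma finite_edge_cut: "finite (edge_cut E X)"
  using finite_E by (simp add: edge_cut_def)

lemma d_eq_sum: "d X = (\<Sum>e\<in>E. of_bool (card (e \<inter> X) = 1))"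
  using finite_E by (simp add: edge_cut_def Int_def)

text \<open>It suffices to compare the contributions of a single edge. Only edges between
  \<open>X - Y\<close> and \<open>Y - X\<close> leave slack.\<close>

lemma d_submodular: "d (X \<inter> Y) + d (X \<union> Y) \<le> d X + d Y"
  unfolding d_eq_sum sum.distrib[symmetric]
proof (rule sum_mono)
  fix e assume "e \<in> E"
  then obtain a b where "a \<noteq> b" "e = {a, b}" by (rule edgeE)
  then show "of_bool (card (e \<inter> (X \<inter> Y)) = 1) + of_bool (card (e \<inter> (X \<union> Y)) = 1)
    \<le> (of_bool (card (e \<inter> X) = 1) + of_bool (card (e \<inter> Y) = 1) :: nat)"
    by (auto simp: card_doubleton_Int)
qed

text \<open>Again edge by edge; here the slack comes from edges between \<open>X \<inter> Y\<close>
  and the outside of \<open>X \<union> Y\<close>.\<close>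

lemma d_posimodular: "d (X - Y) + d (Y - X) \<le> d X + d Y"
  unfolding d_eq_sum sum.distrib[symmetric]
proof (rule sum_mono)
  fix e assume "e \<in> E"
  then obtain a b where "a \<noteq> b" "e = {a, b}" by (rule edgeE)
  then show "of_bool (card (e \<inter> (X - Y)) = 1) + of_bool (card (e \<inter> (Y - X)) = 1)
    \<le> (of_bool (card (e \<inter> X) = 1) + of_bool (card (e \<inter> Y) = 1) :: nat)"
    by (auto simp: card_doubleton_Int)
qed

lemma d_complement: "d (V - X) = d X"
  unfolding d_eq_sum
proof (rule sum.cong)
  fix e assume "e \<in> E"
  then obtain a b where "a \<noteq> b" "e = {a, b}" "a \<in> V" "b \<in> V" by (rule edgeE)
  then show "of_bool (card (e \<inter> (V - X)) = 1) = (of_bool (card (e \<inter> X) = 1) :: nat)"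
    by (auto simp: card_doubleton_Int)
qed simp

lemma d_singleton: "d {v} = deg v"
proof -
  have "edge_cut E {v} = {e \<in> E. v \<in> e}"
    by (auto simp: edge_cut_def Int_insert_right)
  then show ?thesis by (simp add: degree_def)
qed

lemma sum_deg:
  assumes "finite S"
  shows "(\<Sum>v\<in>S. deg v) = d S + 2 * card {e \<in> E. e \<subseteq> S}"
proof -
  have "(\<Sum>v\<in>S. deg v) = (\<Sum>v\<in>S. \<Sum>e\<in>E. of_bool (v \<in> e))"
    using finite_E by (simp add: degree_def Int_def)
  also have "\<dots> = (\<Sum>e\<in>E. \<Sum>v\<in>S. of_bool (v \<in> e))"
    by (rule sum.swap)
  also have "\<dots> = (\<Sum>e\<in>E. of_bool (card (e \<inter> S) = 1) + 2 * of_bool (e \<subseteq> S))"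
  proof (rule sum.cong)
    fix e assume "e \<in> E"
    then obtain a b where e: "a \<noteq> b" "e = {a, b}" by (rule edgeE)
    have "(\<Sum>v\<in>S. of_bool (v \<in> e)) = card (e \<inter> S)"
      using assms by (simp add: Int_def conj_commute)
    with e show "(\<Sum>v\<in>S. of_bool (v \<in> e))
        = (of_bool (card (e \<inter> S) = 1) + 2 * of_bool (e \<subseteq> S) :: nat)"
      by (auto simp: card_doubleton_Int)
  qed simp
  also have "\<dots> = d S + 2 * card {e \<in> E. e \<subseteq> S}"
    unfolding d_eq_sum sum.distrib sum_distrib_left[symmetric]
    using finite_E by (simp add: Int_def)
  finally show ?thesis .
qed

lemma double_choose_two: "2 * (n choose 2) = n * (n - 1)"
proof -
  have "even (n * (n - 1))" by (cases "even n") auto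
  then show ?thesis unfolding choose_two by (rule dvd_mult_div_cancel)
qed

text \<open>The absence of loops and parallel edges enters the degree counts here: edges inside
  \<open>S\<close> are distinct two-element subsets.\<close>

lemma card_inner_edges:
  assumes "finite S"
  shows "2 * card {e \<in> E. e \<subseteq> S} \<le> card S * (card S - 1)"
proof -
  have "card {e \<in> E. e \<subseteq> S} \<le> card {e. e \<subseteq> S \<and> card e = 2}"
    by (rule card_mono) (use assms card_edge in auto)
  also have "\<dots> = card S choose 2"
    using n_subsets[OF assms] by simp
  finally show ?thesis using double_choose_two[of "card S"] by linarith
qed

lemma \<delta>_le_deg: "v \<in> V \<Longrightarrow> \<delta> \<le> deg v"
  unfolding min_degree_def using finite_V by simp

text \<open>Serves counts in which only the representatives in \<open>T\<close> have degrees known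
  to be large; every other vertex of \<open>S\<close> contributes just \<delta>.\<close>

lemma deg_sum_ge:
  assumes "S \<subseteq> V" "T \<subseteq> S"
  shows "(\<Sum>v\<in>T. deg v) + (card S - card T) * \<delta> \<le> (\<Sum>v\<in>S. deg v)"
proof -
  have fin: "finite S" by (rule finite_subset[OF assms(1) finite_V])
  then have fin': "finite T" by (rule finite_subset[OF assms(2)])
  have "(card S - card T) * \<delta> = (\<Sum>v\<in>S - T. \<delta>)"
    using card_Diff_subset[OF fin' assms(2)] by simp
  also have "\<dots> \<le> (\<Sum>v\<in>S - T. deg v)"
    by (rule sum_mono) (use assms \<delta>_le_deg in auto)
  finally show ?thesis
    using sum.subset_diff[OF assms(2) fin, of deg] by simp
qed

text \<open>With \<open>k + 1\<close> vertices in \<open>X\<close>, the degree sum is at least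
  \<open>deg b + k * \<delta>\<close> and at most \<open>d X + (k + 1) * k\<close>. Since
  \<open>d X < deg b\<close>, this forces \<open>k * \<delta> < k * (k + 1)\<close>. It bounds the
  size of leaf blocks.\<close>

lemma card_side_gt:
  assumes "X \<subseteq> V" "b \<in> X" "d X < deg b"
  shows "\<delta> < card X"
proof -
  have fin: "finite X" by (rule finite_subset[OF assms(1) finite_V])
  have "0 < card X" using assms(2) fin by (auto simp: card_gt_0_iff)
  then obtain k where k: "card X = Suc k" using gr0_conv_Suc by blast
  have "deg b + k * \<delta> \<le> (\<Sum>v\<in>X. deg v)"
    using deg_sum_ge[OF assms(1), of "{b}"] assms k by simp
  also have "\<dots> \<le> d X + Suc k * k"
    using sum_deg[OF fin] card_inner_edges[OF fin] k by simp
  finally have "k * \<delta> < k * Suc k" using assms(3) by (simp add: algebra_simps)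
  then show ?thesis using k unfolding mult_less_cancel1 by simp
qed

section \<open>Minimum separating cuts and uncrossing\<close>

text \<open>The second summand breaks ties in favour of unbalanced cuts; it makes uncrossing strict.\<close>

definition tie_cut :: "'a set \<Rightarrow> nat" where
  "tie_cut X = Suc (card V * card V) * d X + card X * card (V - X)"

lemma tie_cut_complement: "X \<subseteq> V \<Longrightarrow> tie_cut (V - X) = tie_cut X"
  by (simp add: tie_cut_def d_complement double_diff)

text \<open>The balance term is at most \<open>card V * card V\<close>, hence less than the weight
  of one edge, so the order by \<open>tie_cut\<close> is lexicographic with \<open>d\<close>
  first.\<close>

lemma tie_cut_mono:
  assumes "tie_cut X \<le> tie_cut Y" "Y \<subseteq> V"
  shows "d X \<le> d Y"
proof (rule ccontr)
  let ?N = "card V * card V"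
  assume "\<not> d X \<le> d Y"
  then have "Suc ?N * Suc (d Y) \<le> Suc ?N * d X"
    by (intro mult_le_mono) auto
  moreover have "card Y * card (V - Y) \<le> ?N"
    by (intro mult_le_mono card_mono finite_V assms) auto
  ultimately show False using assms(1) by (simp add: tie_cut_def)
qed

text \<open>Expressing all sizes by the four Venn regions turns comparisons of balance terms into
  polynomial identities.\<close>

lemma cards_of_two_sets:
  fixes X Y :: "'a set"
  assumes "X \<subseteq> V" "Y \<subseteq> V"
  defines "p \<equiv> card (X \<inter> Y)" and "q \<equiv> card (X - Y)" and "s \<equiv> card (Y - X)"
    and "t \<equiv> card (V - (X \<union> Y))"
  shows "card X = p + q" "card Y = p + s" "card (X \<union> Y) = p + q + s"
    "card (V - X) = s + t" "card (V - Y) = q + t"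
    "card (V - X \<inter> Y) = q + s + t" "card (V - (X - Y)) = p + s + t"
    "card (V - (Y - X)) = p + q + t"
proof -
  have split: "card A = card (A \<inter> B) + card (A - B)" if "A \<subseteq> V" for A B
    using that finite_V card_Int_Diff finite_subset by blast
  show X: "card X = p + q"
    using split[OF assms(1), of Y] by (simp add: p_def q_def)
  show "card Y = p + s"
    using split[OF assms(2), of X] by (simp add: p_def s_def Int_commute)
  have "(X \<union> Y) \<inter> X = X" "X \<union> Y - X = Y - X" by auto
  then show "card (X \<union> Y) = p + q + s"
    using split[of "X \<union> Y" X] assms(1,2) X by (simp add: s_def)
  have "(V - X) \<inter> Y = Y - X" "V - X - Y = V - (X \<union> Y)" using assms by auto
  then show VX: "card (V - X) = s + t"
    using split[of "V - X" Y] by (simp add: s_def t_def)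
  have "(V - Y) \<inter> X = X - Y" "V - Y - X = V - (X \<union> Y)" using assms by auto
  then show VY: "card (V - Y) = q + t"
    using split[of "V - Y" X] by (simp add: q_def t_def)
  have "(V - X \<inter> Y) \<inter> X = X - Y" "V - X \<inter> Y - X = V - X" using assms by auto
  then show "card (V - X \<inter> Y) = q + s + t"
    using split[of "V - X \<inter> Y" X] VX by (simp add: q_def)
  have "(V - (X - Y)) \<inter> X = X \<inter> Y" "V - (X - Y) - X = V - X" using assms by auto
  then show "card (V - (X - Y)) = p + s + t"
    using split[of "V - (X - Y)" X] VX by (simp add: p_def)
  have "(V - (Y - X)) \<inter> Y = X \<inter> Y" "V - (Y - X) - Y = V - Y" using assms by auto
  then show "card (V - (Y - X)) = p + q + t"
    using split[of "V - (Y - X)" Y] VY by (simp add: p_def)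
qed

text \<open>The balance terms alone drop by twice \<open>card (X - Y) * card (Y - X)\<close>, which
  is positive; the edge terms are submodular.\<close>

lemma tie_cut_submodular:
  assumes "X \<subseteq> V" "Y \<subseteq> V" "\<not> X \<subseteq> Y" "\<not> Y \<subseteq> X"
  shows "tie_cut (X \<inter> Y) + tie_cut (X \<union> Y) < tie_cut X + tie_cut Y"
proof -
  have "0 < card (X - Y) * card (Y - X)"
    using assms finite_V by (auto simp: card_gt_0_iff intro: finite_subset)
  then have "card (X \<inter> Y) * card (V - X \<inter> Y) + card (X \<union> Y) * card (V - (X \<union> Y))
      < card X * card (V - X) + card Y * card (V - Y)"
    unfolding cards_of_two_sets[OF assms(1,2)] by (simp add: algebra_simps)
  moreover have "Suc (card V * card V) * (d (X \<inter> Y) + d (X \<union> Y))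
      \<le> Suc (card V * card V) * (d X + d Y)"
    by (intro mult_le_mono2 d_submodular)
  ultimately show ?thesis unfolding tie_cut_def by (simp only: distrib_left)
qed

text \<open>Here the balance terms drop by twice
  \<open>card (X \<inter> Y) * card (V - (X \<union> Y))\<close>.\<close>

lemma tie_cut_posimodular:
  assumes "X \<subseteq> V" "Y \<subseteq> V" "X \<inter> Y \<noteq> {}" "X \<union> Y \<noteq> V"
  shows "tie_cut (X - Y) + tie_cut (Y - X) < tie_cut X + tie_cut Y"
proof -
  have "0 < card (X \<inter> Y) * card (V - (X \<union> Y))"
    using assms finite_V by (auto simp: card_gt_0_iff intro: finite_subset)
  then have "card (X - Y) * card (V - (X - Y)) + card (Y - X) * card (V - (Y - X))
      < card X * card (V - X) + card Y * card (V - Y)"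
    unfolding cards_of_two_sets[OF assms(1,2)] by (simp add: algebra_simps)
  moreover have "Suc (card V * card V) * (d (X - Y) + d (Y - X))
      \<le> Suc (card V * card V) * (d X + d Y)"
    by (intro mult_le_mono2 d_posimodular)
  ultimately show ?thesis unfolding tie_cut_def by (simp only: distrib_left)
qed

text \<open>The cut is unoriented: \<open>X\<close> may contain either one of \<open>u\<close> and
  \<open>v\<close>, so that complements can be taken freely.\<close>

definition min_sep :: "'a \<Rightarrow> 'a \<Rightarrow> 'a set \<Rightarrow> bool" where
  "min_sep u v X \<longleftrightarrow> X \<subseteq> V \<and> (u \<in> X) \<noteq> (v \<in> X) \<and>
     (\<forall>Y \<subseteq> V. (u \<in> Y) \<noteq> (v \<in> Y) \<longrightarrow> tie_cut X \<le> tie_cut Y)"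

lemma min_sep_le:
  "min_sep u v X \<Longrightarrow> Y \<subseteq> V \<Longrightarrow> (u \<in> Y) \<noteq> (v \<in> Y) \<Longrightarrow> tie_cut X \<le> tie_cut Y"
  by (auto simp: min_sep_def)

lemma min_sep_complement:
  assumes "min_sep u v X" "u \<in> V" "v \<in> V"
  shows "min_sep u v (V - X)"
  using assms tie_cut_complement[of X] by (auto simp: min_sep_def)

lemma ex_min_sep:
  assumes "u \<in> V" "u \<noteq> v"
  shows "\<exists>X. min_sep u v X"
proof -
  let ?P = "\<lambda>X. X \<subseteq> V \<and> (u \<in> X) \<noteq> (v \<in> X)"
  have "?P {u}" using assms by auto
  then obtain X where "?P X" "\<forall>Y. ?P Y \<longrightarrow> tie_cut X \<le> tie_cut Y"
    using ex_has_least_nat[of ?P "{u}" tie_cut] by auto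
  then show ?thesis unfolding min_sep_def by (intro exI[of _ X]) simp
qed

text \<open>If \<open>X\<close> and \<open>Y\<close> crossed, both uncrossing inequalities would be
  strict. The corners that still separate one of the two pairs are at least as heavy as the
  corresponding minimum cut, and there are enough of them for a contradiction.\<close>

lemma min_sep_cross_free:
  assumes X: "min_sep u v X" and Y: "min_sep s t Y"
  shows "X \<subseteq> Y \<or> Y \<subseteq> X \<or> X \<inter> Y = {} \<or> X \<union> Y = V"
proof (rule ccontr)
  assume cross: "\<not> ?thesis"
  have sub: "X \<subseteq> V" "Y \<subseteq> V" using X Y by (auto simp: min_sep_def)
  have sm: "tie_cut (X \<inter> Y) + tie_cut (X \<union> Y) < tie_cut X + tie_cut Y"
    and pm: "tie_cut (X - Y) + tie_cut (Y - X) < tie_cut X + tie_cut Y"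
    using tie_cut_submodular[OF sub] tie_cut_posimodular[OF sub] cross by auto
  have sep: "(u \<in> X) \<noteq> (v \<in> X)" "(s \<in> Y) \<noteq> (t \<in> Y)"
    using X Y by (auto simp: min_sep_def)
  have subs: "X \<inter> Y \<subseteq> V" "X \<union> Y \<subseteq> V" "X - Y \<subseteq> V" "Y - X \<subseteq> V"
    using sub by auto
  note le = subs[THEN min_sep_le[OF X]] subs[THEN min_sep_le[OF Y]]
  let ?i = "tie_cut (X \<inter> Y)" and ?u = "tie_cut (X \<union> Y)" and ?l = "tie_cut (X - Y)"
    and ?r = "tie_cut (Y - X)" and ?x = "tie_cut X" and ?y = "tie_cut Y"
  \<comment> \<open>The propositional core: \<open>uX\<close> stands for membership of
    \<open>u\<close> in \<open>X\<close>, and \<open>xi\<close> for \<open>?x \<le> ?i\<close>,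
    similarly for the other letters. In the first four cases \<open>X\<close> and \<open>Y\<close>
    are bounded by two opposite corners, one each, against \<open>sm\<close> or \<open>pm\<close>.
    In the last two, one set is bounded by both corners of \<open>sm\<close> and the other by both
    corners of \<open>pm\<close>, against the sum of \<open>sm\<close> and
    \<open>pm\<close>.\<close>
  have combine: "xi \<and> yu \<or> yi \<and> xu \<or> xl \<and> yr \<or> yl \<and> xr
      \<or> xi \<and> xu \<and> yl \<and> yr \<or> yi \<and> yu \<and> xl \<and> xr"
    if "uX \<noteq> vX" "sY \<noteq> tY"
      "(uX \<and> uY) \<noteq> (vX \<and> vY) \<Longrightarrow> xi" "(uX \<or> uY) \<noteq> (vX \<or> vY) \<Longrightarrow> xu"
      "(uX \<and> \<not> uY) \<noteq> (vX \<and> \<not> vY) \<Longrightarrow> xl" "(uY \<and> \<not> uX) \<noteq> (vY \<and> \<not> vX) \<Longrightarrow> xr"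
      "(sX \<and> sY) \<noteq> (tX \<and> tY) \<Longrightarrow> yi" "(sX \<or> sY) \<noteq> (tX \<or> tY) \<Longrightarrow> yu"
      "(sX \<and> \<not> sY) \<noteq> (tX \<and> \<not> tY) \<Longrightarrow> yl" "(sY \<and> \<not> sX) \<noteq> (tY \<and> \<not> tX) \<Longrightarrow> yr"
    for uX vX uY vY sX tX sY tY xi xu xl xr yi yu yl yr
    using that by (cases uX; cases uY; cases vY; cases sX; cases sY; cases tX; simp)
  have "?x \<le> ?i \<and> ?y \<le> ?u \<or> ?y \<le> ?i \<and> ?x \<le> ?u \<or> ?x \<le> ?l \<and> ?y \<le> ?r \<or> ?y \<le> ?l \<and> ?x \<le> ?r
    \<or> ?x \<le> ?i \<and> ?x \<le> ?u \<and> ?y \<le> ?l \<and> ?y \<le> ?r \<or> ?y \<le> ?i \<and> ?y \<le> ?u \<and> ?x \<le> ?l \<and> ?x \<le> ?r"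
    by (rule combine[OF sep le[unfolded Int_iff Un_iff Diff_iff]])
  with sm pm show False by linarith
qed

end

section \<open>Connectivity bounds and chains of cuts\<close>

lemma not_connected_graphI:
  assumes "u \<in> V" "v \<in> V" "u \<in> X" "v \<notin> X"
    and closed: "\<And>x y. {x, y} \<in> E \<Longrightarrow> x \<in> X \<Longrightarrow> y \<in> X"
  shows "\<not> connected_graph V E"
proof
  assume "connected_graph V E"
  then have "(u, v) \<in> {(x, y). {x, y} \<in> E}\<^sup>*"
    using assms(1,2) by (auto simp: connected_graph_def)
  then have "v \<in> X"
    by (induction rule: rtrancl_induct) (use assms(3) closed in auto)
  with assms(4) show False by simp
qed

context finite_simple_graph
begin

lemma edge_cut_doubleton_iff:
  assumes "{x, y} \<in> E"
  shows "{x, y} \<in> edge_cut E X \<longleftrightarrow> (x \<in> X) \<noteq> (y \<in> X)"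
proof -
  have "x \<noteq> y" using card_edge[OF assms] by auto
  then show ?thesis using assms by (simp add: edge_cut_def card_doubleton_Int)
qed

lemma edge_connectivity_le:
  assumes "x \<in> X" "y \<in> V - X" "X \<subseteq> V"
  shows "edge_connectivity V E \<le> d X"
proof (cases "card V \<le> 1")
  case False
  have "edge_cut E X \<subseteq> E" by (auto simp: edge_cut_def)
  moreover have "\<not> connected_graph V (E - edge_cut E X)"
  proof (rule not_connected_graphI[where X = X])
    show "x \<in> V" "y \<in> V" "x \<in> X" "y \<notin> X" using assms by auto
    show "b \<in> X" if "{a, b} \<in> E - edge_cut E X" "a \<in> X" for a b
      using that edge_cut_doubleton_iff[of a b X] by auto
  qed
  moreover have "finite {card F |F. F \<subseteq> E \<and> \<not> connected_graph V (E - F)}"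
    by (rule finite_subset[of _ "card ` Pow E"]) (use finite_E in auto)
  ultimately show ?thesis
    unfolding edge_connectivity_def if_not_P[OF False] by (intro Min_le) auto
qed (simp add: edge_connectivity_def)

text \<open>Every edge leaving \<open>X\<close> loses an endpoint when \<open>C\<close> is deleted,
  so the surviving vertices \<open>x\<close> and \<open>y\<close> lie in different
  components.\<close>

lemma vertex_connectivity_le:
  assumes "C \<subseteq> V" "x \<in> X - C" "y \<in> V - X - C" "X \<subseteq> V"
    and cover: "\<And>e. e \<in> edge_cut E X \<Longrightarrow> e \<inter> C \<noteq> {}"
  shows "vertex_connectivity V E \<le> card C"
proof -
  have "\<not> connected_graph (V - C) {e \<in> E. e \<inter> C = {}}"
  proof (rule not_connected_graphI[where X = X])
    show "x \<in> V - C" "y \<in> V - C" "x \<in> X" "y \<notin> X" using assms by auto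
    show "b \<in> X" if "{a, b} \<in> {e \<in> E. e \<inter> C = {}}" "a \<in> X" for a b
      using that cover[of "{a, b}"] edge_cut_doubleton_iff[of a b X] by auto
  qed
  moreover have "finite {card S |S. S \<subseteq> V \<and>
       (\<not> connected_graph (V - S) {e \<in> E. e \<inter> S = {}} \<or> card (V - S) \<le> 1)}"
    by (rule finite_subset[of _ "card ` Pow V"]) (use finite_V in auto)
  ultimately show ?thesis
    unfolding vertex_connectivity_def using assms(1) by (intro Min_le) auto
qed

lemma edge_cut_meets:
  assumes "e \<in> edge_cut E X"
  shows "e \<inter> X \<noteq> {}"
  using assms by (auto simp: edge_cut_def)

definition well_connected :: bool where
  "well_connected \<longleftrightarrow> \<delta> \<ge> 5 \<or> edge_connectivity V E \<ge> 4 \<or> vertex_connectivity V E \<ge> 3"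

text \<open>This treats three consecutive blocks of degree 2 in the tree, with union
  \<open>S\<close>. As \<open>d S \<le> d X + d W\<close>, the degrees of \<open>b\<^sub>1\<close>
  and \<open>b\<^sub>3\<close> pay for the edges leaving \<open>S\<close>. What remains must fit
  into the edges inside \<open>S\<close>, whose number is limited by the size of
  \<open>S\<close>.\<close>

lemma card_chain_ge:
  assumes chain: "W \<subset> Z" "Z \<subset> Y" "Y \<subset> X" "X \<subset> V" "W \<noteq> {}"
    and b: "b\<^sub>1 \<in> X - Y" "b\<^sub>2 \<in> Y - Z" "b\<^sub>3 \<in> Z - W"
    and deg: "d X < deg b\<^sub>1" "d Y < deg b\<^sub>2" "d W < deg b\<^sub>3"
    and wc: well_connected
  shows "15 + \<delta> \<le> 5 * card (X - W)"
proof -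
  define S where "S = X - W"
  define T where "T = {b\<^sub>1, b\<^sub>2, b\<^sub>3}"
  define i where "i = card {e \<in> E. e \<subseteq> S}"
  have sub: "S \<subseteq> V" "T \<subseteq> S" using chain b by (auto simp: S_def T_def)
  have fin: "finite S" by (rule finite_subset[OF sub(1) finite_V])
  have dist: "b\<^sub>1 \<noteq> b\<^sub>2" "b\<^sub>1 \<noteq> b\<^sub>3" "b\<^sub>2 \<noteq> b\<^sub>3" using chain b by auto
  then have cardT: "card T = 3" by (simp add: T_def)
  then obtain t where t: "card S = t + 3"
    using card_mono[OF fin sub(2)] by (metis le_add_diff_inverse2)
  have "W - X = {}" using chain by auto
  then have dS: "d S \<le> d X + d W"
    using d_posimodular[of X W] by (simp add: S_def)
  have "deg b\<^sub>1 + deg b\<^sub>2 + deg b\<^sub>3 + t * \<delta> \<le> d S + 2 * i"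
    using deg_sum_ge[OF sub] sum_deg[OF fin] dist t cardT by (simp add: T_def i_def)
  then have count: "deg b\<^sub>2 + 2 + t * \<delta> \<le> 2 * i"
    using deg dS by linarith
  have i_le: "2 * i \<le> (t + 3) * (t + 2)"
    using card_inner_edges[OF fin] t by (simp add: i_def)
  have b2V: "b\<^sub>2 \<in> V" using b chain by auto
  \<comment> \<open>Uses \<open>(t + 3) * (t + 2) - 2 = (t + 1) * (t + 4)\<close>.\<close>
  have "Suc t * \<delta> \<le> Suc t * (t + 4)"
    using count i_le \<delta>_le_deg[OF b2V] by (simp add: algebra_simps)
  then have \<delta>_le: "\<delta> \<le> t + 4" unfolding mult_le_cancel1 by simp
  \<comment> \<open>For \<open>t = 0\<close> each block is a single vertex. The count then gives
    \<open>\<delta> \<le> 4\<close> and \<open>d Y \<le> 3\<close>, which leaves only the assumption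
    on vertex-connectivity. It is refuted by covering the cut around \<open>Y\<close> with at most
    two vertices.\<close>
  have "t \<noteq> 0"
  proof
    assume "t = 0"
    then have ST: "S = T"
      using card_subset_eq[OF fin sub(2)] t cardT by simp
    have deg2: "deg b\<^sub>2 \<le> 4" and dY: "d Y \<le> 3"
      using count i_le \<open>t = 0\<close> deg(2) by auto
    obtain w where w: "w \<in> W" using chain(5) by blast
    have YV: "Y \<subseteq> V" using chain by auto
    have "edge_connectivity V E \<le> d Y"
      by (rule edge_connectivity_le[of b\<^sub>2 _ b\<^sub>1]) (use chain b in auto)
    then have \<kappa>: "vertex_connectivity V E \<ge> 3"
      using wc \<delta>_le \<open>t = 0\<close> dY by (auto simp: well_connected_def)
    show False
    proof (cases "d Y \<le> 2")
      case True
      \<comment> \<open>One endpoint in \<open>Y\<close> of each cut edge gives at most two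
        vertices. They cannot exhaust \<open>Y\<close>, which contains \<open>b\<^sub>2\<close>,
        \<open>b\<^sub>3\<close> and a vertex of \<open>W\<close>.\<close>
      define f where "f = (\<lambda>e. SOME x. x \<in> e \<inter> Y)"
      have f: "f e \<in> e \<inter> Y" if "e \<in> edge_cut E Y" for e
        unfolding f_def by (rule someI_ex) (use edge_cut_meets[OF that] in auto)
      let ?C = "f ` edge_cut E Y"
      have C2: "card ?C \<le> 2"
        using card_image_le[OF finite_edge_cut, of f Y] True by linarith
      have "b\<^sub>2 \<noteq> w" "b\<^sub>3 \<noteq> w" using b chain w by auto
      then have "card {b\<^sub>2, b\<^sub>3, w} = 3" using dist(3) by simp
      moreover have "card {b\<^sub>2, b\<^sub>3, w} \<le> card ?C" if "{b\<^sub>2, b\<^sub>3, w} \<subseteq> ?C"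
        by (rule card_mono[OF finite_imageI[OF finite_edge_cut] that])
      ultimately have "\<not> {b\<^sub>2, b\<^sub>3, w} \<subseteq> ?C" using C2 by linarith
      moreover have "{b\<^sub>2, b\<^sub>3, w} \<subseteq> Y" using b chain w by auto
      ultimately obtain x where x: "x \<in> Y - ?C" by blast
      have CY: "?C \<subseteq> Y" using f by blast
      have "vertex_connectivity V E \<le> card ?C"
      proof (rule vertex_connectivity_le[OF _ x])
        show "?C \<subseteq> V" using CY YV by (rule subset_trans)
        show "b\<^sub>1 \<in> V - Y - ?C" using CY b chain by blast
        show "e \<inter> ?C \<noteq> {}" if "e \<in> edge_cut E Y" for e
          using f[OF that] that by blast
      qed (rule YV)
      with C2 \<kappa> show False by simp
    next
      case False
      then have "deg b\<^sub>2 = 4" "d Y = 3" using deg(2) deg2 dY by auto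
      then have "i \<ge> 3" using count \<open>t = 0\<close> by simp
      \<comment> \<open>Equality holds throughout the count, so the three representatives form a triangle.\<close>
      have "card {e. e \<subseteq> S \<and> card e = 2} \<le> card {e \<in> E. e \<subseteq> S}"
        using n_subsets[OF fin, of 2] t \<open>t = 0\<close> \<open>i \<ge> 3\<close> by (simp add: i_def choose_two)
      then have "{e \<in> E. e \<subseteq> S} = {e. e \<subseteq> S \<and> card e = 2}"
        by (intro card_seteq) (use fin card_edge in auto)
      moreover have "{b\<^sub>1, b\<^sub>2} \<subseteq> S" "card {b\<^sub>1, b\<^sub>2} = 2" "{b\<^sub>1, b\<^sub>3} \<subseteq> S" "card {b\<^sub>1, b\<^sub>3} = 2"
        using ST dist by (auto simp: T_def)
      ultimately have "{b\<^sub>1, b\<^sub>2} \<in> E" "{b\<^sub>1, b\<^sub>3} \<in> E" by blast+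
      then have cut: "{b\<^sub>1, b\<^sub>2} \<in> edge_cut E Y" "{b\<^sub>1, b\<^sub>3} \<in> edge_cut E Y"
        using b chain by (auto simp: edge_cut_doubleton_iff)
      have "{b\<^sub>1, b\<^sub>2} \<noteq> {b\<^sub>1, b\<^sub>3}" using dist by (auto simp: doubleton_eq_iff)
      \<comment> \<open>Two of the three cut edges meet in \<open>b\<^sub>1\<close>, so
        \<open>b\<^sub>1\<close> and one endpoint of the third edge cover the cut.\<close>
      then have "card (edge_cut E Y - {{b\<^sub>1, b\<^sub>2}, {b\<^sub>1, b\<^sub>3}}) = 1"
        using cut \<open>d Y = 3\<close> by (subst card_Diff_subset) auto
      then obtain e where e: "edge_cut E Y - {{b\<^sub>1, b\<^sub>2}, {b\<^sub>1, b\<^sub>3}} = {e}"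
        by (auto simp: card_1_singleton_iff)
      then obtain y where y: "y \<in> e" "y \<in> Y" using edge_cut_meets[of e Y] by blast
      obtain x where x: "x \<in> Y - {b\<^sub>1, y}" using b chain dist by blast
      \<comment> \<open>As \<open>X\<close> is a proper subset of \<open>V\<close>, some vertex lies
        outside \<open>X\<close> and thus differs from \<open>b\<^sub>1\<close>.\<close>
      obtain z where z: "z \<in> V - Y - {b\<^sub>1, y}" using b chain y by blast
      have "vertex_connectivity V E \<le> card {b\<^sub>1, y}"
      proof (rule vertex_connectivity_le[OF _ x z])
        show "{b\<^sub>1, y} \<subseteq> V" "Y \<subseteq> V" using b chain y by auto
        show "e' \<inter> {b\<^sub>1, y} \<noteq> {}" if "e' \<in> edge_cut E Y" for e'
        proof (cases "e' = e")
          case False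
          then have "e' = {b\<^sub>1, b\<^sub>2} \<or> e' = {b\<^sub>1, b\<^sub>3}" using e that by blast
          then show ?thesis by auto
        qed (use y in auto)
      qed
      also have "\<dots> \<le> 2" by (simp add: card_insert_if)
      finally show False using \<kappa> by simp
    qed
  qed
  \<comment> \<open>For \<open>t \<ge> 1\<close>,
    \<open>15 + \<delta> \<le> 19 + t \<le> 5 * (t + 3)\<close>.\<close>
  then show ?thesis using \<delta>_le t by (simp add: S_def)
qed

section \<open>Nonpendant pairs and minimal families of cuts\<close>

definition nonpendant :: "'a \<Rightarrow> 'a \<Rightarrow> bool" where
  "nonpendant u v \<longleftrightarrow> u \<in> V \<and> v \<in> V \<and> u \<noteq> v \<and> {u, v} \<notin> pendant_pairs V E"

text \<open>Singletons show that the local edge-connectivity never exceeds either degree; for a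
  nonpendant pair it therefore lies strictly below both. A minimizer of \<open>tie_cut\<close>
  attains it.\<close>

lemma nonpendant_cut:
  assumes np: "nonpendant u v" and X: "min_sep u v X"
  shows "d X < deg u" "d X < deg v"
proof -
  let ?C = "{d X |X. X \<subseteq> V \<and> (u \<in> X) \<noteq> (v \<in> X)}"
  have uv: "u \<in> V" "v \<in> V" "u \<noteq> v" and "{u, v} \<notin> pendant_pairs V E"
    using np by (auto simp: nonpendant_def)
  then have ne: "Min ?C \<noteq> min (deg u) (deg v)"
    by (auto simp: pendant_pairs_def local_edge_connectivity_def)
  have fin: "finite ?C"
    by (rule finite_subset[of _ "d ` Pow V"]) (use finite_V in auto)
  have "d {u} \<in> ?C" "d {v} \<in> ?C" using uv by blast+
  then have le: "Min ?C \<le> deg u" "Min ?C \<le> deg v" and "?C \<noteq> {}"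
    using fin Min_le[of ?C] unfolding d_singleton by auto
  then obtain Y where Y: "Min ?C = d Y" "Y \<subseteq> V" "(u \<in> Y) \<noteq> (v \<in> Y)"
    using Min_in[OF fin] by blast
  then have "d X \<le> Min ?C"
    using tie_cut_mono[OF min_sep_le[OF X]] by auto
  with le ne show "d X < deg u" "d X < deg v" by (auto simp: min_def split: if_splits)
qed

end

text \<open>The root \<open>r\<close> selects one side of each cut, so that cross-free becomes
  laminar. \<open>private_pair\<close> records the minimality of the family: a heavier member may
  separate the pair of \<open>X\<close> too, but no other member of at most the same weight.\<close>

locale minimal_cut_family = finite_simple_graph +
  fixes r :: 'a and F :: "'a set set"
  assumes root: "r \<in> V"
    and family: "F \<subseteq> Pow (V - {r})"
    and laminar: "X \<in> F \<Longrightarrow> Y \<in> F \<Longrightarrow> X \<subseteq> Y \<or> Y \<subseteq> X \<or> X \<inter> Y = {}"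
    and separates: "nonpendant u v \<Longrightarrow> \<exists>X\<in>F. (u \<in> X) \<noteq> (v \<in> X)"
    and private_pair: "X \<in> F \<Longrightarrow> \<exists>u\<in>X. \<exists>v\<in>V - X. d X < deg u \<and> d X < deg v \<and>
      (\<forall>Y\<in>F. (u \<in> Y) \<noteq> (v \<in> Y) \<and> tie_cut Y \<le> tie_cut X \<longrightarrow> Y = X)"

text \<open>Start from all minimum cuts of nonpendant pairs, taken on the side avoiding
  \<open>r\<close>, and pass to an inclusion-minimal subfamily that still has a minimum cut for each
  such pair. Avoiding \<open>r\<close> rules out \<open>X \<union> Y = V\<close>.\<close>

lemma (in finite_simple_graph) ex_minimal_cut_family:
  assumes r: "r \<in> V"
  obtains F where "minimal_cut_family V E r F"
proof -
  define F0 where "F0 = {X. X \<subseteq> V - {r} \<and> (\<exists>u v. nonpendant u v \<and> min_sep u v X)}"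
  define covers where
    "covers F \<longleftrightarrow> (\<forall>u v. nonpendant u v \<longrightarrow> (\<exists>X\<in>F. min_sep u v X))" for F
  have "covers F0"
    unfolding covers_def
  proof (intro allI impI)
    fix u v assume np: "nonpendant u v"
    then have uv: "u \<in> V" "v \<in> V" "u \<noteq> v" by (auto simp: nonpendant_def)
    obtain X where X: "min_sep u v X" using ex_min_sep[OF uv(1,3)] by blast
    then have "X \<subseteq> V" by (simp add: min_sep_def)
    show "\<exists>X\<in>F0. min_sep u v X"
    proof (cases "r \<in> X")
      case True
      then have "V - X \<in> F0"
        using np min_sep_complement[OF X uv(1,2)] by (auto simp: F0_def)
      then show ?thesis using min_sep_complement[OF X uv(1,2)] by blast
    next
      case False
      then have "X \<in> F0" using np X \<open>X \<subseteq> V\<close> by (auto simp: F0_def)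
      then show ?thesis using X by blast
    qed
  qed
  moreover have "finite F0"
    by (rule finite_subset[of _ "Pow V"]) (use finite_V in \<open>auto simp: F0_def\<close>)
  ultimately obtain F where F: "F \<subseteq> F0" "covers F"
    and "\<forall>G. G \<subseteq> F0 \<and> covers G \<longrightarrow> G \<subseteq> F \<longrightarrow> F = G"
    using finite_has_minimal2[of "{G. G \<subseteq> F0 \<and> covers G}" F0] by auto
  then have minimal: "G = F" if "G \<subseteq> F" "covers G" for G
    using that by blast
  show thesis
  proof (rule that, unfold_locales)
    show "r \<in> V" by (rule r)
    show "F \<subseteq> Pow (V - {r})" using F(1) by (auto simp: F0_def)
    show "\<exists>X\<in>F. (u \<in> X) \<noteq> (v \<in> X)" if "nonpendant u v" for u v
    proof -
      obtain X where "X \<in> F" "min_sep u v X" using F(2) \<open>nonpendant u v\<close> by (auto simp: covers_def)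
      then show ?thesis by (auto simp: min_sep_def)
    qed
    show "X \<subseteq> Y \<or> Y \<subseteq> X \<or> X \<inter> Y = {}" if "X \<in> F" "Y \<in> F" for X Y
    proof -
      have "X \<in> F0" "Y \<in> F0" using that F(1) by auto
      then obtain u v s t where "min_sep u v X" "min_sep s t Y"
        and sub: "X \<subseteq> V - {r}" "Y \<subseteq> V - {r}" by (auto simp: F0_def)
      then have "X \<subseteq> Y \<or> Y \<subseteq> X \<or> X \<inter> Y = {} \<or> X \<union> Y = V"
        by (intro min_sep_cross_free)
      with sub r show ?thesis by blast
    qed
    fix X assume XF: "X \<in> F"
    \<comment> \<open>By minimality some nonpendant pair has \<open>X\<close> as its only minimum
      cut in \<open>F\<close>.\<close>
    have "\<not> covers (F - {X})" using minimal[of "F - {X}"] XF by auto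
    then obtain u v where np: "nonpendant u v" and "\<not> (\<exists>Y\<in>F - {X}. min_sep u v Y)"
      by (auto simp: covers_def)
    then have priv: "Y = X" if "Y \<in> F" "min_sep u v Y" for Y using that by auto
    moreover obtain Y where "Y \<in> F" "min_sep u v Y" using F(2) np by (auto simp: covers_def)
    ultimately have X: "min_sep u v X" by metis
    \<comment> \<open>A member no heavier than \<open>X\<close> that separates the pair is itself a
      minimum cut for it.\<close>
    have unique: "Y = X" if "Y \<in> F" "(u \<in> Y) \<noteq> (v \<in> Y)" "tie_cut Y \<le> tie_cut X" for Y
    proof (rule priv[OF that(1)])
      have "Y \<subseteq> V" using that(1) F(1) by (auto simp: F0_def)
      with that(2,3) show "min_sep u v Y"
        using min_sep_le[OF X] order_trans unfolding min_sep_def by metis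
    qed
    have deg: "d X < deg u" "d X < deg v" using nonpendant_cut[OF np X] .
    have "(u \<in> X) \<noteq> (v \<in> X)" "u \<in> V" "v \<in> V"
      using X np by (auto simp: min_sep_def nonpendant_def)
    then consider "u \<in> X" "v \<in> V - X" | "v \<in> X" "u \<in> V - X" by blast
    then show "\<exists>u\<in>X. \<exists>v\<in>V - X. d X < deg u \<and> d X < deg v \<and>
      (\<forall>Y\<in>F. (u \<in> Y) \<noteq> (v \<in> Y) \<and> tie_cut Y \<le> tie_cut X \<longrightarrow> Y = X)"
    proof cases
      case 1
      with deg unique show ?thesis by blast
    next
      case 2
      with deg unique show ?thesis by (intro bexI[of _ v] bexI[of _ u]) auto
    qed
  qed
qed

section \<open>The tree of cuts and its blocks\<close>

context minimal_cut_family
begin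

text \<open>\<open>X\<close> may also be \<open>V\<close>, the root of the tree, which is not a
  member of \<open>F\<close>.\<close>

definition children :: "'a set \<Rightarrow> 'a set set" where
  "children X = {Z \<in> F. Z \<subset> X \<and> (\<forall>W\<in>F. Z \<subset> W \<longrightarrow> \<not> W \<subset> X)}"

definition block :: "'a set \<Rightarrow> 'a set" where
  "block X = X - \<Union>(children X)"

lemma F_psubset: "X \<in> F \<Longrightarrow> X \<subset> V"
  using family root by blast

lemma finite_F: "finite F"
  by (rule finite_subset[OF family]) (simp add: finite_V)

lemma F_nonempty: "X \<in> F \<Longrightarrow> X \<noteq> {}"
  using private_pair by blast

lemma childrenD: "Z \<in> children X \<Longrightarrow> Z \<in> F \<and> Z \<subset> X"
  by (simp add: children_def)

lemma finite_children: "finite (children X)"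
  by (rule finite_subset[OF _ finite_F]) (auto simp: children_def)

lemma ex_child:
  assumes "Y \<in> F" "Y \<subset> X"
  shows "\<exists>Z\<in>children X. Y \<subseteq> Z"
proof -
  have "finite {W \<in> F. W \<subset> X}" using finite_F by simp
  then obtain Z where "Z \<in> F" "Z \<subset> X" "Y \<subseteq> Z"
    and "\<forall>W. W \<in> F \<and> W \<subset> X \<longrightarrow> Z \<subseteq> W \<longrightarrow> Z = W"
    using finite_has_maximal2[of "{W \<in> F. W \<subset> X}" Y] assms by auto
  then show ?thesis by (auto simp: children_def)
qed

lemma children_disjoint:
  assumes "Y \<in> children X" "Z \<in> children X" "Y \<noteq> Z"
  shows "Y \<inter> Z = {}"
  using assms laminar[of Y Z] unfolding children_def by blast

lemma block_subset: "block X \<subseteq> X"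
  by (auto simp: block_def)

text \<open>A cut of \<open>F\<close> separating two vertices of the block would by laminarity lie
  properly inside \<open>X\<close>, hence inside a child, and children are disjoint from the
  block.\<close>

lemma block_pendant:
  assumes X: "X \<in> insert V F" and uv: "u \<in> block X" "v \<in> block X" "u \<noteq> v"
  shows "{u, v} \<in> pendant_pairs V E"
proof (rule ccontr)
  assume "{u, v} \<notin> pendant_pairs V E"
  moreover have uvX: "u \<in> X" "v \<in> X" using uv block_subset by blast+
  moreover have "X \<subseteq> V" using X F_psubset by auto
  ultimately have "nonpendant u v" using uv(3) by (auto simp: nonpendant_def)
  then obtain Y where Y: "Y \<in> F" "(u \<in> Y) \<noteq> (v \<in> Y)" using separates by blast
  then have "X \<subseteq> Y \<or> Y \<subseteq> X \<or> X \<inter> Y = {}"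
    using X laminar F_psubset by blast
  then have "Y \<subset> X" using Y(2) uvX by blast
  then obtain Z where "Z \<in> children X" "Y \<subseteq> Z" using ex_child Y(1) by blast
  then show False using uv Y(2) by (auto simp: block_def)
qed

text \<open>
  Among the cuts around a block take one of maximal weight. The endpoint of its private pair
  on the side of the block lies in the block, as any other cut around the block that contains
  it would separate the private pair too.
\<close>

lemma block_representative:
  assumes X: "X \<in> insert V F" and ne: "children X \<union> ({X} \<inter> F) \<noteq> {}"
  shows "\<exists>b\<in>block X. \<forall>Z\<in>children X \<union> ({X} \<inter> F). d Z < deg b"
proof -
  \<comment> \<open>The cuts around the block: those of the children and that of \<open>X\<close>
    itself, the latter dropped by the intersection if \<open>X = V\<close>.\<close>
  let ?C = "children X \<union> ({X} \<inter> F)"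
  have CF: "Z \<in> F" if "Z \<in> ?C" for Z using that childrenD by blast
  have "finite (tie_cut ` ?C)" using finite_children by simp
  then have "Max (tie_cut ` ?C) \<in> tie_cut ` ?C" using ne by (intro Max_in) auto
  then obtain W where W: "Max (tie_cut ` ?C) = tie_cut W" "W \<in> ?C"
    by (rule imageE)
  have max: "tie_cut Z \<le> tie_cut W" if "Z \<in> ?C" for Z
    unfolding W(1)[symmetric] by (rule Max_ge) (use finite_children that in auto)
  have le: "d Z \<le> d W" if "Z \<in> ?C" for Z
    using tie_cut_mono[OF max[OF that]] F_psubset[OF CF[OF W(2)]] by simp
  obtain u v where uv: "u \<in> W" "v \<in> V - W" "d W < deg u" "d W < deg v"
    and "\<forall>Y\<in>F. (u \<in> Y) \<noteq> (v \<in> Y) \<and> tie_cut Y \<le> tie_cut W \<longrightarrow> Y = W"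
    using private_pair[OF CF[OF W(2)]] by blast
  then have unique: "Z = W" if "Z \<in> ?C" "(u \<in> Z) \<noteq> (v \<in> Z)" for Z
    using that(2) max[OF that(1)] CF[OF that(1)] by simp
  show ?thesis
  proof (cases "W \<in> children X")
    case True
    then have WX: "W \<subset> X" using childrenD by blast
    have "v \<in> X"
    proof (rule ccontr)
      assume "v \<notin> X"
      then have "X \<in> ?C" using X uv(2) by auto
      moreover have "u \<in> X" using uv(1) WX by blast
      ultimately have "X = W" using unique[of X] \<open>v \<notin> X\<close> by simp
      with WX show False by simp
    qed
    moreover have "v \<notin> Z" if "Z \<in> children X" for Z
    proof
      assume "v \<in> Z"
      then have "Z \<noteq> W" using uv(2) by auto
      then have "u \<notin> Z" using children_disjoint[OF that True] uv(1) by auto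
      with \<open>v \<in> Z\<close> \<open>Z \<noteq> W\<close> show False using unique[of Z] that by simp
    qed
    ultimately have "v \<in> block X" by (auto simp: block_def)
    then show ?thesis using le_less_trans[OF le uv(4)] by blast
  next
    case False
    then have "W = X" using W(2) by blast
    have "u \<notin> Z" if "Z \<in> children X" for Z
    proof
      assume "u \<in> Z"
      moreover have "v \<notin> Z" using childrenD[OF that] uv(2) \<open>W = X\<close> by auto
      ultimately have "Z = W" using unique[of Z] that by simp
      then show False using childrenD[OF that] \<open>W = X\<close> by simp
    qed
    then have "u \<in> block X" using uv(1) \<open>W = X\<close> by (auto simp: block_def)
    then show ?thesis using le_less_trans[OF le uv(3)] by blast
  qed
qed

section \<open>Counting pendant pairs along the tree\<close>

text \<open>The surplus of pendant pairs inside \<open>X\<close> over the target, scaled by 30; the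
  goal is \<open>0 \<le> \<Phi> V\<close>.\<close>

definition \<Phi> :: "'a set \<Rightarrow> real" where
  "\<Phi> X = 30 * real (card {p \<in> pendant_pairs V E. p \<subseteq> X}) - real \<delta> * real (card X)"

lemma finite_pendant_pairs: "finite (pendant_pairs V E)"
  by (rule finite_subset[of _ "Pow V"]) (use finite_V in \<open>auto simp: pendant_pairs_def\<close>)

text \<open>Pairs with one vertex in each set are given away; no pair is counted twice, as pairs are
  nonempty.\<close>

lemma \<Phi>_Un:
  assumes "A \<subseteq> V" "B \<subseteq> V" "A \<inter> B = {}"
  shows "\<Phi> A + \<Phi> B \<le> \<Phi> (A \<union> B)"
proof -
  let ?P = "\<lambda>X. {p \<in> pendant_pairs V E. p \<subseteq> X}"
  have "{} \<notin> pendant_pairs V E" by (auto simp: pendant_pairs_def)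
  moreover have "p = {}" if "p \<subseteq> A" "p \<subseteq> B" for p using that assms(3) by blast
  ultimately have disj: "?P A \<inter> ?P B = {}" by auto
  have "card (?P A) + card (?P B) = card (?P A \<union> ?P B)"
    using finite_pendant_pairs disj by (intro card_Un_disjoint[symmetric]) auto
  also have "\<dots> \<le> card (?P (A \<union> B))"
    using finite_pendant_pairs by (intro card_mono) auto
  finally have "real (card (?P A)) + real (card (?P B)) \<le> real (card (?P (A \<union> B)))"
    by linarith
  moreover have "card (A \<union> B) = card A + card B"
    using assms by (intro card_Un_disjoint) (auto intro: finite_subset[OF _ finite_V])
  ultimately show ?thesis unfolding \<Phi>_def by (simp add: distrib_left)
qed

lemma \<Phi>_Union:
  assumes "finite C" "A \<subseteq> V" "\<And>Z. Z \<in> C \<Longrightarrow> Z \<subseteq> V" "\<And>Z. Z \<in> C \<Longrightarrow> A \<inter> Z = {}"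
    "\<And>Y Z. Y \<in> C \<Longrightarrow> Z \<in> C \<Longrightarrow> Y \<noteq> Z \<Longrightarrow> Y \<inter> Z = {}"
  shows "\<Phi> A + (\<Sum>Z\<in>C. \<Phi> Z) \<le> \<Phi> (A \<union> \<Union>C)"
  using assms
proof (induction C rule: finite_induct)
  case (insert Y C)
  have "\<Phi> A + (\<Sum>Z\<in>C. \<Phi> Z) \<le> \<Phi> (A \<union> \<Union>C)"
    using insert.prems by (intro insert.IH) auto
  moreover have "Y \<inter> Z = {}" if "Z \<in> C" for Z
    using insert.prems(4)[of Y Z] insert.hyps(2) that by auto
  then have "(A \<union> \<Union>C) \<inter> Y = {}" using insert.prems(3) by blast
  then have "\<Phi> (A \<union> \<Union>C) + \<Phi> Y \<le> \<Phi> ((A \<union> \<Union>C) \<union> Y)"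
    using insert.prems(1,2) by (intro \<Phi>_Un) auto
  moreover have "(A \<union> \<Union>C) \<union> Y = A \<union> \<Union>(insert Y C)" by auto
  ultimately show ?case using insert.hyps by simp
qed simp

lemma \<Phi>_ge_children:
  assumes "X \<in> insert V F"
  shows "\<Phi> (block X) + (\<Sum>Z\<in>children X. \<Phi> Z) \<le> \<Phi> X"
proof -
  have "X \<subseteq> V" using assms F_psubset by auto
  then have "\<Phi> (block X) + (\<Sum>Z\<in>children X. \<Phi> Z) \<le> \<Phi> (block X \<union> \<Union>(children X))"
  proof (intro \<Phi>_Union finite_children)
    show "block X \<subseteq> V" using \<open>X \<subseteq> V\<close> block_subset by blast
    show "Z \<subseteq> V" "block X \<inter> Z = {}" if "Z \<in> children X" for Z
      using that childrenD[OF that] \<open>X \<subseteq> V\<close> by (auto simp: block_def)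
  qed (rule children_disjoint)
  also have "block X \<union> \<Union>(children X) = X"
    using childrenD by (auto simp: block_def)
  finally show ?thesis .
qed

text \<open>All pairs inside a block are pendant, so there are exactly
  \<open>s * (s - 1) / 2\<close> of them.\<close>

lemma \<Phi>_block:
  assumes "X \<in> insert V F"
  defines "s \<equiv> real (card (block X))"
  shows "\<Phi> (block X) = s * (15 * s - 15 - \<delta>)"
proof -
  have sub: "block X \<subseteq> V" using assms(1) F_psubset block_subset by blast
  have fin: "finite (block X)" by (rule finite_subset[OF sub finite_V])
  have "{p \<in> pendant_pairs V E. p \<subseteq> block X} = {p. p \<subseteq> block X \<and> card p = 2}"
    (is "?L = ?R")
  proof
    show "?L \<subseteq> ?R" by (auto simp: pendant_pairs_def)
    show "?R \<subseteq> ?L" using block_pendant[OF assms(1)] by (auto simp: card_2_iff)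
  qed
  then have "2 * card {p \<in> pendant_pairs V E. p \<subseteq> block X} = card (block X) * (card (block X) - 1)"
    using n_subsets[OF fin, of 2] double_choose_two by simp
  from arg_cong[where f = real, OF this]
  have "2 * real (card {p \<in> pendant_pairs V E. p \<subseteq> block X})
      = real (card (block X) * (card (block X) - 1))"
    by (simp only: of_nat_mult of_nat_numeral)
  also have "\<dots> = s * (s - 1)"
    unfolding s_def by (cases "card (block X)") (auto simp: algebra_simps)
  finally have "2 * real (card {p \<in> pendant_pairs V E. p \<subseteq> block X}) = s * (s - 1)" .
  then show ?thesis unfolding \<Phi>_def s_def[symmetric] by (simp add: algebra_simps)
qed

text \<open>\<open>- m\<close> is the minimum of \<open>\<Phi> (block X)\<close> as a quadratic polynomial in the block size.\<close>

definition m :: real where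
  "m = (15 + \<delta>)\<^sup>2 / 60"

lemma m_nonneg: "0 \<le> m"
  by (simp add: m_def)

lemma \<Phi>_block_ge:
  assumes "X \<in> insert V F"
  shows "- m \<le> \<Phi> (block X)"
proof -
  define s where "s = real (card (block X))"
  \<comment> \<open>Completing the square; the vertex of the parabola is at
    \<open>(15 + \<delta>) / 30\<close>.\<close>
  have "0 \<le> 15 * (s - (15 + \<delta>) / 30)\<^sup>2" by simp
  also have "\<dots> = s * (15 * s - 15 - \<delta>) + m"
    by (simp add: m_def power2_eq_square field_simps)
  finally show ?thesis using \<Phi>_block[OF assms] by (simp add: s_def)
qed

text \<open>For size at least \<open>\<delta> + 1\<close> the quadratic is at least
  \<open>(\<delta> + 1) * 14 * \<delta>\<close>, which exceeds \<open>5 * m\<close> as soon as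
  \<open>\<delta> \<ge> 1\<close>.\<close>

lemma \<Phi>_large_block:
  assumes X: "X \<in> insert V F" and large: "\<delta> < card (block X)" and pos: "0 < \<delta>"
  shows "5 * m \<le> \<Phi> (block X)"
proof -
  define s where "s = real (card (block X))"
  define k where "k = real \<delta>"
  have k: "1 \<le> k" "k + 1 \<le> s" using large pos by (auto simp: s_def k_def)
  have "1 \<le> k * k" using mult_mono[of 1 k 1 k] k by simp
  have "5 * m = (k * k + 30 * k + 225) / 12"
    by (simp add: m_def k_def power2_eq_square field_simps)
  also have "\<dots> \<le> (k + 1) * (14 * k)"
    using k \<open>1 \<le> k * k\<close> by (simp add: field_simps)
  also have "\<dots> \<le> s * (15 * s - 15 - k)"
    using k by (intro mult_mono) auto
  finally show ?thesis using \<Phi>_block[OF X] by (simp add: s_def k_def)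
qed

text \<open>By convexity the sum is smallest for equal sizes, where the assumed size bound is
  exactly what makes the remaining factor nonnegative. The squares of differences are the exact
  error term.\<close>

lemma \<Phi>_three_blocks:
  assumes "X \<in> insert V F" "Y \<in> insert V F" "Z \<in> insert V F"
    and "15 + \<delta> \<le> 5 * (card (block X) + card (block Y) + card (block Z))"
  shows "0 \<le> \<Phi> (block X) + \<Phi> (block Y) + \<Phi> (block Z)"
proof -
  define a b c where "a = real (card (block X))" and "b = real (card (block Y))"
    and "c = real (card (block Z))"
  have "real (15 + \<delta>) \<le> real (5 * (card (block X) + card (block Y) + card (block Z)))"
    using assms(4) by (rule of_nat_mono)
  then have "15 + real \<delta> \<le> 5 * (a + b + c)" by (simp add: a_def b_def c_def)
  then have "0 \<le> (a + b + c) * (5 * (a + b + c) - 15 - \<delta>)"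
    by (intro mult_nonneg_nonneg) (auto simp: a_def b_def c_def)
  moreover have "0 \<le> 5 * ((a - b)\<^sup>2 + (b - c)\<^sup>2 + (c - a)\<^sup>2)" by simp
  moreover have "\<Phi> (block X) + \<Phi> (block Y) + \<Phi> (block Z) =
      (a + b + c) * (5 * (a + b + c) - 15 - \<delta>) + 5 * ((a - b)\<^sup>2 + (b - c)\<^sup>2 + (c - a)\<^sup>2)"
    unfolding \<Phi>_block[OF assms(1)] \<Phi>_block[OF assms(2)] \<Phi>_block[OF assms(3)]
      a_def[symmetric] b_def[symmetric] c_def[symmetric]
    by algebra
  ultimately show ?thesis by linarith
qed

text \<open>A leaf has \<open>5 * m\<close> by its size, and two or more children give
  \<open>2 * 3 * m - m = 5 * m\<close>. A vertex with a single child loses at most \<open>m\<close>,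
  so up to two such steps above a leaf or a branching keep \<open>3 * m\<close>. Three such steps in
  a row lose nothing, since their blocks together have nonnegative surplus.\<close>

lemma \<Phi>_ge_family:
  assumes wc: well_connected and pos: "0 < \<delta>"
  shows "X \<in> F \<Longrightarrow> 3 * m \<le> \<Phi> X \<and> (card (children X) \<noteq> 1 \<longrightarrow> 5 * m \<le> \<Phi> X)"
proof (induction "card X" arbitrary: X rule: less_induct)
  case less
  have IH: "3 * m \<le> \<Phi> Z" "card (children Z) \<noteq> 1 \<Longrightarrow> 5 * m \<le> \<Phi> Z" if "Z \<in> F" "Z \<subset> X" for Z
    using less that psubset_card_mono[OF _ that(2)] F_psubset[OF less.prems]
      finite_subset[OF _ finite_V] by auto
  have single: "\<Phi> (block Y) + \<Phi> Z \<le> \<Phi> Y" "block Y = Y - Z" "Z \<in> F" "Z \<subset> Y"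
    if "Y \<in> F" "children Y = {Z}" for Y Z
    using \<Phi>_ge_children[of Y] childrenD[of Z Y] that by (auto simp: block_def)
  have X: "X \<in> insert V F" using less.prems by simp
  consider "card (children X) = 0" | "card (children X) = 1" | "card (children X) \<ge> 2"
    by linarith
  then show ?case
  proof cases
    case 1
    then have ch: "children X = {}" using finite_children by simp
    then have "block X = X" by (simp add: block_def)
    then obtain b where "b \<in> X" "d X < deg b"
      using block_representative[OF X] less.prems by auto
    then have "\<delta> < card X" using card_side_gt F_psubset[OF less.prems] by blast
    then show ?thesis
      using \<Phi>_large_block[OF X _ pos] m_nonneg \<open>block X = X\<close> by simp
  next
    case 3
    have "real (card (children X)) * (3 * m) \<le> (\<Sum>Z\<in>children X. \<Phi> Z)"
      using childrenD IH(1) by (intro sum_bounded_below) auto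
    moreover have "2 * (3 * m) \<le> real (card (children X)) * (3 * m)"
      using 3 m_nonneg by (intro mult_right_mono) auto
    ultimately have "5 * m \<le> \<Phi> X"
      using \<Phi>_ge_children[OF X] \<Phi>_block_ge[OF X] by linarith
    then show ?thesis using m_nonneg by simp
  next
    case 2
    then obtain Y where "children X = {Y}" by (auto simp: card_1_singleton_iff)
    note Y = single[OF less.prems this] this
    have "3 * m \<le> \<Phi> X"
    proof (cases "card (children Y) = 1")
      case False
      then show ?thesis using IH(2)[of Y] Y \<Phi>_block_ge[OF X] m_nonneg by auto
    next
      case True
      then obtain Z where "children Y = {Z}" by (auto simp: card_1_singleton_iff)
      note Z = single[OF Y(3) this] this
      have ZX: "Z \<subset> X" using Y Z by blast
      show ?thesis
      proof (cases "card (children Z) = 1")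
        case False
        then show ?thesis
          using IH(2)[of Z] ZX Y Z \<Phi>_block_ge[OF X] \<Phi>_block_ge[of Y] m_nonneg by auto
      next
        case True
        then obtain W where "children Z = {W}" by (auto simp: card_1_singleton_iff)
        note W = single[OF Z(3) this] this
        have WX: "W \<subset> X" using ZX W by blast
        \<comment> \<open>Each representative exceeds both cuts around its block. The cuts
          \<open>X\<close> and \<open>W\<close>, which bound \<open>X - W\<close>, are used for the
          outer two, and \<open>Y\<close> for the middle one.\<close>
        obtain b\<^sub>1 where b1: "b\<^sub>1 \<in> X - Y" "d X < deg b\<^sub>1"
          using block_representative[OF X] Y less.prems by auto
        obtain b\<^sub>2 where b2: "b\<^sub>2 \<in> Y - Z" "d Y < deg b\<^sub>2"
          using block_representative[of Y] Y(3) Z by auto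
        obtain b\<^sub>3 where b3: "b\<^sub>3 \<in> Z - W" "d W < deg b\<^sub>3"
          using block_representative[of Z] Z(3) W by auto
        have "15 + \<delta> \<le> 5 * card (X - W)"
          using card_chain_ge[OF W(4) Z(4) Y(4) F_psubset[OF less.prems] F_nonempty[OF W(3)]]
            b1 b2 b3 wc by blast
        moreover have "X - W = (X - Y) \<union> (Y - Z) \<union> (Z - W)" using Y(4) Z(4) W(4) by blast
        moreover have "card \<dots> \<le> card (X - Y) + card (Y - Z) + card (Z - W)"
          by (meson card_Un_le add_le_mono1 order_trans)
        ultimately have "15 + \<delta> \<le> 5 * (card (block X) + card (block Y) + card (block Z))"
          using Y(2) Z(2) W(2) by simp
        then have "0 \<le> \<Phi> (block X) + \<Phi> (block Y) + \<Phi> (block Z)"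
          using \<Phi>_three_blocks X Y(3) Z(3) by blast
        then show ?thesis using Y(1) Z(1) W(1) IH(1)[OF W(3) WX] by linarith
      qed
    qed
    then show ?thesis using 2 by simp
  qed
qed

text \<open>Without children, \<open>V\<close> is one block, and \<open>d V = 0 < deg r\<close>
  makes it large. Otherwise some child contributes \<open>3 * m\<close>, which pays for the root
  block.\<close>

lemma \<Phi>_nonneg:
  assumes wc: well_connected and pos: "0 < \<delta>"
  shows "0 \<le> \<Phi> V"
proof -
  have ge: "3 * m \<le> \<Phi> Z" if "Z \<in> children V" for Z
    using \<Phi>_ge_family[OF wc pos] that childrenD by blast
  have sum: "real (card (children V)) * (3 * m) \<le> (\<Sum>Z\<in>children V. \<Phi> Z)"
    using ge by (intro sum_bounded_below) auto
  show ?thesis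
  proof (cases "card (children V) = 0")
    case True
    then have "block V = V" using finite_children by (simp add: block_def)
    have "d V = 0" using d_complement[of "{}"] by (simp add: edge_cut_def)
    then have "\<delta> < card V"
      using card_side_gt[OF _ root] \<delta>_le_deg[OF root] pos by simp
    then show ?thesis
      using \<Phi>_large_block[of V] pos m_nonneg \<open>block V = V\<close> by simp
  next
    case False
    then have "1 * (3 * m) \<le> real (card (children V)) * (3 * m)"
      using m_nonneg by (intro mult_right_mono) auto
    then show ?thesis
      using sum \<Phi>_ge_children[of V] \<Phi>_block_ge[of V] m_nonneg by simp
  qed
qed

end

theorem theorem8:
  fixes V :: "'a set" and E :: "'a set set"
  assumes "simple_graph V E"
    and "min_degree V E \<ge> 5 \<or> edge_connectivity V E \<ge> 4 \<or> vertex_connectivity V E \<ge> 3"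
  shows "real (card (pendant_pairs V E)) \<ge> 1 / 30 * real (min_degree V E) * real (card V)"
\<comment> \<open>In these degenerate cases the bound is 0: for empty \<open>V\<close> the minimum
  degree is a \<open>Min\<close> over the empty set, but the factor \<open>card V\<close>
  vanishes.\<close>
proof (cases "V = {} \<or> min_degree V E = 0")
  case False
  interpret finite_simple_graph V E by unfold_locales fact
  obtain r where "r \<in> V" using False by blast
  from ex_minimal_cut_family[OF this] obtain F where "minimal_cut_family V E r F" .
  then interpret minimal_cut_family V E r F .
  have "0 \<le> \<Phi> V"
    using \<Phi>_nonneg False assms(2) by (simp add: well_connected_def)
  moreover have "{p \<in> pendant_pairs V E. p \<subseteq> V} = pendant_pairs V E"
    by (auto simp: pendant_pairs_def)
  ultimately show ?thesis by (simp add: \<Phi>_def)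
qed auto

end
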